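(* Let $n\ge2$ be an integer that is not of the form $2^{\ell}$ for any $\ell\in\mathbb N$. If $0.4371985206<r\le0.4384471872$, then $\alpha_n(I)$ does not form an optimal CVT with $n$-means for $P$; that is, $\alpha_n(I)$ (for any admissible $I$ and any choice of the sets $A_\sigma$) is not an optimal set of $n$-means for $P$.
   Context: Let $0<r<\frac12$, $S_1(x)=rx$, $S_2(x)=rx+(1-r)$ on $\mathbb R$; $P$ is the unique Borel probability measure on $\mathbb R$ with $P=\frac12P\circ S_1^{-1}+\frac12P\circ S_2^{-1}$. For a word $\sigma=\sigma_1\cdots\sigma_k\in\{1,2\}^k$ put $S_\sigma=S_{\sigma_1}\circ\cdots\circ S_{\sigma_k}$ and $J_\sigma=S_\sigma([0,1])$; $\emptyset$ is the empty word ($S_\emptyset=\mathrm{id}$, $\{1,2\}^0=\{\emptyset\}$), and $\sigma\tau$ denotes concatenation. For words $\beta,\dots,\delta$, $a(\beta,\dots,\delta)=\frac{1}{P(J_\beta\cup\cdots\cup J_\delta)}\int_{J_\beta\cup\cdots\cup J_\delta}x\,dP(x)$. For each word $\sigma$, $A_\sigma$ denotes one of the two sets (chosen arbitrarily and independently for each $\sigma$) $\{a(\sigma11,\sigma121,\sigma1221),\ a(\sigma1222,\sigma21),\ a(\sigma22)\}$ or $\{a(\sigma11),\ a(\sigma12,\sigma2111),\ a(\sigma2112,\sigma212,\sigma22)\}$. Definition of $\alpha_n(I)$ for $n\geq 2$ not a power of $2$. Let $\ell=\ell(n)$ be the integer with $2^{\ell}<n<2^{\ell+1}$. (1) If $n=2^{\ell}+k$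 with $1\le k\le2^{\ell-1}$, then $I\subseteq\{1,2\}^{\ell-1}$ with $\mathrm{card}(I)=k$ and $\alpha_n(I)=\bigcup_{\sigma\in I}A_\sigma\cup\{S_{\sigma1}(\frac12),S_{\sigma2}(\frac12):\sigma\in\{1,2\}^{\ell-1}\setminus I\}$ (so $\alpha_n(I)=\bigcup_{\sigma\in I}A_\sigma$ if $k=2^{\ell-1}$, and $\alpha_3(I)=A_\emptyset$). (2) If $n=3\cdot2^{\ell-1}+k$ with $1\le k\le2^{\ell-1}-1$, then $I\subseteq\{1,2\}^{\ell-1}$ with $\mathrm{card}(I)=k$ and $\alpha_n(I)=\bigcup_{\sigma\in\{1,2\}^{\ell-1}\setminus I}A_\sigma\cup\{S_{\sigma\tau}(\frac12):\sigma\in I,\ \tau\in\{1,2\}^2\}$. The distortion error of a finite set $\alpha\subset\mathbb R$ is $V(P;\alpha)=\int\min_{a\in\alpha}(x-a)^2\,dP(x)$. A set $\alpha$ with $\mathrm{card}(\alpha)\le n$ is an optimal set of $n$-means for $P$ if $V(P;\alpha)=\inf\{V(P;\beta):\beta\subset\mathbb R,\ \mathrm{card}(\beta)\le n\}$. A centroidal Voronoi tessellation (a Voronoi tessellation, with respect to $n$ points, whose generating points are the $P$-centroids of their Voronoi regions) is an optimal CVT with $n$-means if its $n$ generators form an optimal set of $n$-means. *)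

theory Defs
  imports "HOL-Probability.Probability"
begin

definition words :: "nat \<Rightarrow> nat list set" where
  "words k = {\<sigma>. length \<sigma> = k \<and> set \<sigma> \<subseteq> {1, 2}}"

text \<open>Only the indices 1 and 2 are meaningful.\<close>

definition sim :: "real \<Rightarrow> nat \<Rightarrow> real \<Rightarrow> real" where
  "sim r i x = (if i = 1 then r * x else r * x + (1 - r))"

primrec word_map :: "real \<Rightarrow> nat list \<Rightarrow> real \<Rightarrow> real" where
  "word_map r [] = id"
| "word_map r (i # \<sigma>) = sim r i \<circ> word_map r \<sigma>"

definition J :: "real \<Rightarrow> nat list \<Rightarrow> real set" where
  "J r \<sigma> = word_map r \<sigma> ` {0..1}"

text \<open>
  For \<open>0 < r < 1/2\<close> there is exactly one such \<open>P\<close> (Hutchinson's theorem).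
\<close>

definition cantor_distribution :: "real \<Rightarrow> real measure \<Rightarrow> bool" where
  "cantor_distribution r P \<longleftrightarrow>
     prob_space P \<and> sets P = sets borel \<and>
     (\<forall>B \<in> sets borel.
        measure P B = 1/2 * measure P (sim r 1 -` B) + 1/2 * measure P (sim r 2 -` B))"

text \<open>Meaningful only if \<open>measure P B > 0\<close>.\<close>

definition centroid :: "real measure \<Rightarrow> real set \<Rightarrow> real" where
  "centroid P B = 1 / measure P B * (LINT x:B|P. x)"

text \<open>The words \<open>\<beta>, \<dots>, \<delta>\<close> in \<open>a(\<beta>, \<dots>, \<delta>)\<close> are passed as a set \<open>W\<close>.\<close>

definition a_pt :: "real \<Rightarrow> real measure \<Rightarrow> nat list set \<Rightarrow> real" where
  "a_pt r P W = centroid P (\<Union>\<sigma>\<in>W. J r \<sigma>)"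

definition A_left :: "real \<Rightarrow> real measure \<Rightarrow> nat list \<Rightarrow> real set" where
  "A_left r P \<sigma> =
     {a_pt r P {\<sigma> @ [1,1], \<sigma> @ [1,2,1], \<sigma> @ [1,2,2,1]},
      a_pt r P {\<sigma> @ [1,2,2,2], \<sigma> @ [2,1]},
      a_pt r P {\<sigma> @ [2,2]}}"

definition A_right :: "real \<Rightarrow> real measure \<Rightarrow> nat list \<Rightarrow> real set" where
  "A_right r P \<sigma> =
     {a_pt r P {\<sigma> @ [1,1]},
      a_pt r P {\<sigma> @ [1,2], \<sigma> @ [2,1,1,1]},
      a_pt r P {\<sigma> @ [2,1,1,2], \<sigma> @ [2,1,2], \<sigma> @ [2,2]}}"

text \<open>
  The level and the sets below are meaningful only for \<open>n \<ge> 2\<close> not a power of \<open>2\<close>; then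
  \<open>level n \<ge> 1\<close> and none of the natural-number subtractions below truncates.
\<close>

definition level :: "nat \<Rightarrow> nat" where
  "level n = (THE l. 2 ^ l < n \<and> n < 2 ^ (l + 1))"

text \<open>
  The first case, \<open>n = 2 ^ l + k\<close> with \<open>1 \<le> k \<le> 2 ^ (l - 1)\<close>, is
  \<open>n \<le> 2 ^ l + 2 ^ (l - 1) = 3 * 2 ^ (l - 1)\<close>; otherwise
  \<open>n = 3 * 2 ^ (l - 1) + k\<close> with \<open>1 \<le> k \<le> 2 ^ (l - 1) - 1\<close>.
\<close>

definition admissible :: "nat \<Rightarrow> nat list set \<Rightarrow> bool" where
  "admissible n I \<longleftrightarrow>
     (let l = level n in
        I \<subseteq> words (l - 1) \<and>
        card I = (if n \<le> 3 * 2 ^ (l - 1) then n - 2 ^ l else n - 3 * 2 ^ (l - 1)))"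

definition alpha :: "real \<Rightarrow> (nat list \<Rightarrow> real set) \<Rightarrow> nat \<Rightarrow> nat list set \<Rightarrow> real set" where
  "alpha r A n I =
     (let l = level n in
        if n \<le> 3 * 2 ^ (l - 1)
        then (\<Union>\<sigma>\<in>I. A \<sigma>) \<union>
             (\<Union>\<sigma>\<in>words (l - 1) - I. {word_map r (\<sigma> @ [1]) (1/2), word_map r (\<sigma> @ [2]) (1/2)})
        else (\<Union>\<sigma>\<in>words (l - 1) - I. A \<sigma>) \<union>
             {word_map r (\<sigma> @ \<tau>) (1/2) | \<sigma> \<tau>. \<sigma> \<in> I \<and> \<tau> \<in> words 2})"

definition distortion :: "real measure \<Rightarrow> real set \<Rightarrow> real" where
  "distortion P \<alpha> = (LINT x|P. Min ((\<lambda>a. (x - a)\<^sup>2) ` \<alpha>))"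

text \<open>The empty set is excluded, as its distortion is not defined.\<close>

definition optimal_means :: "real measure \<Rightarrow> nat \<Rightarrow> real set \<Rightarrow> bool" where
  "optimal_means P n \<alpha> \<longleftrightarrow>
     finite \<alpha> \<and> \<alpha> \<noteq> {} \<and> card \<alpha> \<le> n \<and>
     distortion P \<alpha> = (INF \<beta>\<in>{\<beta>. finite \<beta> \<and> \<beta> \<noteq> {} \<and> card \<beta> \<le> n}. distortion P \<beta>)"

definition voronoi_region :: "real set \<Rightarrow> real \<Rightarrow> real set" where
  "voronoi_region \<alpha> a = {x. \<forall>b\<in>\<alpha>. \<bar>x - a\<bar> \<le> \<bar>x - b\<bar>}"

text \<open>A tessellation is represented by its set of generators.\<close>

definition CVT :: "real measure \<Rightarrow> nat \<Rightarrow> real set \<Rightarrow> bool" where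
  "CVT P n \<alpha> \<longleftrightarrow>
     finite \<alpha> \<and> card \<alpha> = n \<and>
     (\<forall>a\<in>\<alpha>. measure P (voronoi_region \<alpha> a) > 0 \<and> a = centroid P (voronoi_region \<alpha> a))"

definition optimal_CVT :: "real measure \<Rightarrow> nat \<Rightarrow> real set \<Rightarrow> bool" where
  "optimal_CVT P n \<alpha> \<longleftrightarrow> CVT P n \<alpha> \<and> optimal_means P n \<alpha>"

end

theory Submission
  imports Defs "HOL-Library.Sublist"
begin

text \<open>
  Each set \<open>\<alpha>\<^sub>n(I)\<close> is a union of scaled local configurations: one in each cylinder \<open>J\<^sub>\<sigma>\<close> with
  \<open>|\<sigma>| = \<ell> - 1\<close>, namely the image under \<open>S\<^sub>\<sigma>\<close> of a two-point set, of a four-point set, or of one of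
  the two three-point sets \<open>A\<^sub>\<emptyset>\<close>; because \<open>n\<close> is not a power of two, a three-point configuration
  occurs at least once. Distinct cylinders of level \<open>k\<close> are at distance at least
  \<open>r\<^sup>k (1 - 2r) / r\<close>, and every local configuration has points within a quarter of the block
  length of both ends of its block. Since \<open>(1 - 2r) / r \<ge> 1/4\<close> in the range at hand, every point of
  the support has a nearest generator in its own block. By self-similarity the distortion is then
  \<open>(r\<^sup>2/2)\<^sup>k\<close> times the sum of the distortions of the local configurations
  (\<open>distortion_blocks\<close>).

  It therefore suffices to improve a single three-point configuration. The two versions of \<open>A\<^sub>\<emptyset>\<close>
  are mirror images; their cells have masses \<open>7/16, 5/16, 4/16\<close>, in this or the opposite order. Their points are centroids of their Voronoi regions, so the
  distortion is the second moment of \<open>P\<close> minus \<open>(7 c\<^sub>1\<^sup>2 + 5 c\<^sub>2\<^sup>2 + 4 c\<^sub>3\<^sup>2) / 16\<close>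
  (\<open>distortion_A_left\<close>, \<open>distortion_A_right\<close>). For the present \<open>r\<close> the symmetric split
  \<open>6/16, 4/16, 6/16\<close>, with cells \<open>J\<^sub>1\<^sub>1 \<union> J\<^sub>1\<^sub>2\<^sub>1\<close>, \<open>J\<^sub>1\<^sub>2\<^sub>2 \<union> J\<^sub>2\<^sub>1\<^sub>1\<close>, \<open>J\<^sub>2\<^sub>1\<^sub>2 \<union> J\<^sub>2\<^sub>2\<close>, is better by about
  \<open>10\<^sup>-\<^sup>4\<close>. Its centroids are so close to \<open>4/25, 1/2, 21/25\<close> that these rational points, which do not
  depend on \<open>r\<close>, already have smaller distortion (\<open>distortion_better_triple_less\<close>).
  Exchanging one three-point configuration for these points keeps the number of points at most \<open>n\<close>
  and lowers the distortion strictly, which contradicts optimality.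
\<close>

section \<open>Words, similarities and prefix codes\<close>

lemma word_map_append: "word_map r (u @ v) x = word_map r u (word_map r v x)"
  by (induction u) auto

lemma word_map_affine: "word_map r w x = word_map r w 0 + r ^ length w * x"
  by (induction w) (simp_all add: sim_def algebra_simps)

lemma J_append: "J r (u @ v) = word_map r u ` J r v"
  by (auto simp: J_def word_map_append image_iff)

lemma finite_words: "finite (words k)"
  using finite_lists_length_eq[of "{1, 2 :: nat}" k] by (simp add: words_def conj_commute del: One_nat_def)

lemma card_words: "card (words k) = 2 ^ k"
  using card_lists_length_eq[of "{1, 2 :: nat}" k] by (simp add: words_def conj_commute numeral_2_eq_2)

lemma words_0: "words 0 = {[]}"
  by (auto simp: words_def)

lemma words_Suc: "words (Suc k) = (#) 1 ` words k \<union> (#) 2 ` words k"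
  by (auto simp: words_def length_Suc_conv image_iff)

text \<open>
  The words of a prefix code label pairwise disjoint cylinders; the code is complete, that is, its
  cylinders carry the whole measure, exactly if the Kraft sum \<open>mass W\<close> is \<open>1\<close>.
\<close>

definition prefix_code :: "nat list set \<Rightarrow> bool" where
  "prefix_code W \<longleftrightarrow> finite W \<and> (\<forall>w\<in>W. set w \<subseteq> {1, 2}) \<and> (\<forall>u\<in>W. \<forall>v\<in>W. u \<noteq> v \<longrightarrow> u \<parallel> v)"

abbreviation mass :: "nat list set \<Rightarrow> real" where
  "mass W \<equiv> \<Sum>w\<in>W. (1/2) ^ length w"

section \<open>Integration against the self-similar measure\<close>

locale cantor =
  fixes r :: real and P :: "real measure"
  assumes r_pos: "0 < r" and r_less: "r < 1/2" and cantor: "cantor_distribution r P"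
begin

sublocale prob_space P
  using cantor by (simp add: cantor_distribution_def)

lemma sets_P [measurable_cong, simp]: "sets P = sets borel"
  using cantor by (simp add: cantor_distribution_def)

lemma space_P [simp]: "space P = UNIV"
  using sets_eq_imp_space_eq[OF sets_P] by simp

lemma sim_measurable [measurable]: "sim r i \<in> borel_measurable borel"
  by (cases "i = 1") (simp_all add: sim_def[abs_def])

lemma word_map_measurable [measurable]: "word_map r w \<in> borel_measurable borel"
  by (induction w) (auto simp: id_def comp_def)

lemma measure_self_similar:
  assumes "B \<in> sets borel"
  shows "measure P B = 1/2 * measure P (sim r 1 -` B) + 1/2 * measure P (sim r 2 -` B)"
  using cantor assms by (simp add: cantor_distribution_def)

text \<open>
  The measure equation is the case of indicator functions; the general case follows by monotone
  approximation with simple functions.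
\<close>

lemma nn_integral_self_similar:
  assumes "f \<in> borel_measurable borel"
  shows "(\<integral>\<^sup>+x. f x \<partial>P) = ennreal (1/2) * ((\<integral>\<^sup>+x. f (sim r 1 x) \<partial>P) + (\<integral>\<^sup>+x. f (sim r 2 x) \<partial>P))"
  using assms
proof (induction rule: borel_measurable_induct)
  case (cong f g)
  then show ?case by simp
next
  case (set B)
  have im: "(\<integral>\<^sup>+x. indicator B (sim r i x) \<partial>P) = emeasure P (sim r i -` B)" for i
  proof -
    have "(\<lambda>x. indicator B (sim r i x)) = (indicator (sim r i -` B) :: real \<Rightarrow> ennreal)"
      by (auto simp: indicator_def fun_eq_iff)
    moreover have "sim r i -` B \<in> sets P"
      using measurable_sets[OF sim_measurable set, of i] by simp
    ultimately show ?thesis by simp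
  qed
  show ?case
    unfolding im using set
    by (simp add: emeasure_eq_measure measure_self_similar[OF set] add_divide_distrib
          del: ennreal_half flip: ennreal_plus ennreal_mult')
next
  case (mult u c)
  then show ?case
    by (simp add: nn_integral_cmult distrib_left mult.left_commute)
next
  case (add u v)
  then show ?case
    by (simp add: nn_integral_add distrib_left algebra_simps)
next
  case (seq U)
  have 1: "(\<integral>\<^sup>+x. (SUP i. U i) (g x) \<partial>P) = (SUP i. \<integral>\<^sup>+x. U i (g x) \<partial>P)"
    if [measurable]: "g \<in> borel_measurable borel" for g
    using seq by (subst nn_integral_monotone_convergence_SUP[symmetric])
      (auto simp: incseq_def le_fun_def image_comp)
  have 2: "incseq (\<lambda>i. \<integral>\<^sup>+x. U i (g x) \<partial>P)" for g
    using seq by (auto simp: incseq_def le_fun_def intro!: nn_integral_mono)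
  have "(SUP i. \<integral>\<^sup>+x. U i x \<partial>P) = (SUP i. ennreal (1/2) * ((\<integral>\<^sup>+x. U i (sim r 1 x) \<partial>P) + (\<integral>\<^sup>+x. U i (sim r 2 x) \<partial>P)))"
    using seq by simp
  also have "\<dots> = ennreal (1/2) * ((SUP i. (\<integral>\<^sup>+x. U i (sim r 1 x) \<partial>P)) + (SUP i. (\<integral>\<^sup>+x. U i (sim r 2 x) \<partial>P)))"
    by (simp only: SUP_mult_left_ennreal[symmetric] ennreal_SUP_add[OF 2 2])
  finally show ?case
    using 1[of "\<lambda>x. x"] 1[of "sim r 1"] 1[of "sim r 2"] by simp
qed

lemma integrable_sim:
  fixes f :: "real \<Rightarrow> real"
  assumes "integrable P f" and "i \<in> {1, 2}"
  shows "integrable P (\<lambda>x. f (sim r i x))"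
proof -
  have [measurable]: "f \<in> borel_measurable borel"
    using borel_measurable_integrable[OF assms(1)] by simp
  have "(\<integral>\<^sup>+x. ennreal (norm (f x)) \<partial>P) < \<infinity>"
    using assms by (simp add: integrable_iff_bounded)
  then have "(\<integral>\<^sup>+x. ennreal (norm (f (sim r i x))) \<partial>P) < \<infinity>"
    using assms(2) by (subst (asm) nn_integral_self_similar)
      (auto simp: ennreal_mult_less_top less_top ennreal_mult_eq_top_iff)
  then show ?thesis by (simp add: integrable_iff_bounded)
qed

lemma integral_self_similar:
  fixes f :: "real \<Rightarrow> real"
  assumes "integrable P f"
  shows "(LINT x|P. f x) = 1/2 * (LINT x|P. f (sim r 1 x)) + 1/2 * (LINT x|P. f (sim r 2 x))"
proof -
  have [measurable]: "f \<in> borel_measurable borel"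
    using borel_measurable_integrable[OF assms(1)] by simp
  have e: "enn2real (\<integral>\<^sup>+x. ennreal (g x) \<partial>P) =
      1/2 * enn2real (\<integral>\<^sup>+x. ennreal (g (sim r 1 x)) \<partial>P) + 1/2 * enn2real (\<integral>\<^sup>+x. ennreal (g (sim r 2 x)) \<partial>P)"
    if "integrable P g" for g
  proof -
    have [measurable]: "g \<in> borel_measurable borel"
      using borel_measurable_integrable[OF that] by simp
    have fin: "(\<integral>\<^sup>+x. ennreal (g (sim r i x)) \<partial>P) < top" if "i \<in> {1,2}" for i
      using integrable_sim[OF \<open>integrable P g\<close> that] real_integrable_def by (auto simp: less_top)
    have "(\<integral>\<^sup>+x. ennreal (g x) \<partial>P) = ennreal (1/2) *
        ((\<integral>\<^sup>+x. ennreal (g (sim r 1 x)) \<partial>P) + (\<integral>\<^sup>+x. ennreal (g (sim r 2 x)) \<partial>P))"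
      by (rule nn_integral_self_similar) measurable
    then show ?thesis
      using fin by (simp add: enn2real_mult enn2real_plus del: ennreal_half)
  qed
  show ?thesis
    using e[OF assms] e[of "\<lambda>x. - f x"] assms integrable_sim[OF assms]
    by (simp add: real_lebesgue_integral_def algebra_simps)
qed

text \<open>
  A tail event \<open>{x. h x > t}\<close>, with \<open>h x\<close> equal to \<open>- x\<close> or \<open>x - 1\<close>, is pulled back by both
  similarities into the tail event for \<open>t / r\<close>. Self-similarity makes its probability at most that
  of the tails for \<open>t / r ^ k\<close>, which tends to zero.
\<close>

lemma AE_unit_interval: "AE x in P. x \<in> {0..1}"
proof -
  have null: "measure P (h -` {t<..}) = 0"
    if t: "t > 0" and [measurable]: "h \<in> borel_measurable borel"
      and step: "\<And>t i. t > 0 \<Longrightarrow> i \<in> {1,2} \<Longrightarrow> sim r i -` (h -` {t<..}) \<subseteq> h -` {t / r<..}"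
    for h :: "real \<Rightarrow> real" and t
  proof -
    define F where "F t = measure P (h -` {t<..})" for t
    have sets [measurable]: "h -` {t<..} \<in> sets borel" for t
      using measurable_sets[OF that(2), of "{t<..}"] by simp
    have F_step: "F t \<le> F (t / r)" if "t > 0" for t
    proof -
      have "measure P (sim r i -` (h -` {t<..})) \<le> F (t / r)" if "i \<in> {1,2}" for i
        unfolding F_def using step[OF \<open>t > 0\<close> that] by (intro finite_measure_mono) auto
      from this[of 1] this[of 2] show ?thesis
        using measure_self_similar[OF sets, of t] unfolding F_def by simp
    qed
    have F_iter: "F t \<le> F (t / r ^ k)" for k
    proof (induction k)
      case (Suc k)
      then show ?case using F_step[of "t / r ^ k"] t r_pos by (simp add: field_simps)
    qed simp
    have "(\<lambda>k. F (t / r ^ k)) \<longlonglongrightarrow> measure P (\<Inter>k. h -` {t / r ^ k<..})"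
      unfolding F_def
    proof (rule finite_Lim_measure_decseq)
      show "decseq (\<lambda>k. h -` {t / r ^ k<..})"
      proof (rule decseq_SucI)
        fix k
        have "t / r ^ k \<le> t / r ^ Suc k"
          using t r_pos r_less by (simp add: field_simps)
        then show "h -` {t / r ^ Suc k<..} \<subseteq> h -` {t / r ^ k<..}" by auto
      qed
    qed auto
    moreover have "(\<Inter>k. h -` {t / r ^ k<..}) = {}"
    proof -
      have "\<exists>k. h x \<le> t / r ^ k" for x
      proof -
        obtain k where "r ^ k < t / (\<bar>h x\<bar> + 1)"
          using real_arch_pow_inv[of "t / (\<bar>h x\<bar> + 1)" r] t r_less by auto
        then have "r ^ k * (\<bar>h x\<bar> + 1) < t" by (simp add: field_simps)
        then have "\<bar>h x\<bar> + 1 < t / r ^ k" using r_pos by (simp add: field_simps)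
        then show ?thesis by (intro exI[of _ k]) linarith
      qed
      then show ?thesis by (simp add: set_eq_iff not_less)
    qed
    ultimately have "(\<lambda>k. F (t / r ^ k)) \<longlonglongrightarrow> 0" by simp
    then have "F t \<le> 0" by (rule LIMSEQ_le_const) (use F_iter in auto)
    then show ?thesis unfolding F_def by (simp add: measure_le_0_iff)
  qed
  have AE_le: "AE x in P. h x \<le> 0"
    if [measurable]: "h \<in> borel_measurable borel"
      and step: "\<And>t i. t > 0 \<Longrightarrow> i \<in> {1,2} \<Longrightarrow> sim r i -` (h -` {t<..}) \<subseteq> h -` {t / r<..}"
    for h :: "real \<Rightarrow> real"
  proof -
    have "AE x in P. \<forall>n. h x \<le> inverse (real (Suc n))"
    proof (subst AE_all_countable, intro allI)
      fix n
      have "measure P (h -` {inverse (real (Suc n))<..}) = 0"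
        using null[OF _ that] by simp
      then have "h -` {inverse (real (Suc n))<..} \<in> null_sets P"
        using measurable_sets[OF that(1), of "{inverse (real (Suc n))<..}"]
        by (auto simp: null_sets_def emeasure_eq_measure)
      then show "AE x in P. h x \<le> inverse (real (Suc n))"
        by (rule AE_I') auto
    qed
    then show ?thesis
    proof eventually_elim
      case (elim x)
      show ?case
      proof (rule ccontr)
        assume "\<not> h x \<le> 0"
        then obtain n where "inverse (real (Suc n)) < h x" using reals_Archimedean[of "h x"] by auto
        then show False using elim by (meson not_less)
      qed
    qed
  qed
  have "AE x in P. - x \<le> 0"
  proof (rule AE_le)
    fix t :: real and i :: nat assume "t > 0" "i \<in> {1,2}"
    then show "sim r i -` (uminus -` {t<..}) \<subseteq> uminus -` {t / r<..}"
      using r_pos r_less by (auto simp: sim_def field_simps)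
  qed simp
  moreover have "AE x in P. x - 1 \<le> 0"
  proof (rule AE_le)
    fix t :: real and i :: nat assume "t > 0" "i \<in> {1,2}"
    then show "sim r i -` ((\<lambda>x. x - 1) -` {t<..}) \<subseteq> (\<lambda>x. x - 1) -` {t / r<..}"
      using r_pos r_less by (auto simp: sim_def field_simps)
  qed simp
  ultimately show ?thesis by eventually_elim auto
qed

lemma integrable_bounded_on_unit_interval:
  fixes f :: "real \<Rightarrow> real"
  assumes "f \<in> borel_measurable borel" and "\<And>x. x \<in> {0..1} \<Longrightarrow> \<bar>f x\<bar> \<le> C"
  shows "integrable P f"
  using AE_unit_interval assms by (intro integrable_const_bound[of _ C]) auto

section \<open>Cylinders and centroids\<close>

lemma word_map_in_unit_interval: "x \<in> {0..1} \<Longrightarrow> word_map r w x \<in> {0..1}"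
proof (induction w)
  case (Cons i w)
  then have "0 \<le> word_map r w x" "word_map r w x \<le> 1" by auto
  then have "0 \<le> r * word_map r w x" "r * word_map r w x \<le> r"
    using r_pos by (simp_all add: mult_left_le)
  then have "0 \<le> sim r i (word_map r w x)" "sim r i (word_map r w x) \<le> 1"
    using r_less unfolding sim_def by (auto split: if_splits)
  then show ?case by simp
qed simp

lemma J_subset: "J r w \<subseteq> {0..1}"
  unfolding J_def using word_map_in_unit_interval by blast

lemma mem_J_iff: "x \<in> J r w \<longleftrightarrow> word_map r w 0 \<le> x \<and> x \<le> word_map r w 1"
proof
  assume "x \<in> J r w"
  then obtain y where y: "0 \<le> y" "y \<le> 1" and "x = word_map r w y"
    unfolding J_def by auto
  with word_map_affine[of r w y] have "x = word_map r w 0 + r ^ length w * y" by simp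
  then show "word_map r w 0 \<le> x \<and> x \<le> word_map r w 1"
    using y r_pos word_map_affine[of r w 1] by (simp add: mult_left_le)
next
  assume *: "word_map r w 0 \<le> x \<and> x \<le> word_map r w 1"
  have "x = word_map r w ((x - word_map r w 0) / r ^ length w)"
    using r_pos by (subst word_map_affine) simp
  moreover have "(x - word_map r w 0) / r ^ length w \<in> {0..1}"
    using * r_pos word_map_affine[of r w 1] by (simp add: field_simps)
  ultimately show "x \<in> J r w" unfolding J_def by blast
qed

lemma J_sets [measurable]: "J r w \<in> sets borel"
proof -
  have "J r w = {word_map r w 0..word_map r w 1}" using mem_J_iff by auto
  then show ?thesis by simp
qed

lemma word_map_inj: "word_map r w x = word_map r w y \<longleftrightarrow> x = y"
proof -
  have "word_map r w x - word_map r w y = r ^ length w * (x - y)"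
    unfolding right_diff_distrib
    using word_map_affine[of r w x] word_map_affine[of r w y] by linarith
  then show ?thesis using r_pos by auto
qed

lemma sim_images_disjoint:
  assumes "i \<in> {1, 2}" "j \<in> {1, 2}" "i \<noteq> j" "x \<in> {0..1}" "y \<in> {0..1}"
  shows "sim r i x \<noteq> sim r j y"
proof -
  have *: "r * x \<le> r" "r * y \<le> r" "0 \<le> r * x" "0 \<le> r * y"
    using assms r_pos by (simp_all add: mult_left_le)
  consider "i = 1" "j = 2" | "i = 2" "j = 1" using assms(1-3) by blast
  then show ?thesis
  proof cases
    case 1
    then show ?thesis unfolding sim_def using * r_less by simp
  next
    case 2
    then show ?thesis unfolding sim_def using * r_less by simp
  qed
qed

lemma J_parallel_disjoint:
  assumes "u \<parallel> v" "set u \<subseteq> {1, 2}" "set v \<subseteq> {1, 2}"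
  shows "J r u \<inter> J r v = {}"
proof -
  obtain p i u' j v' where uv: "i \<noteq> j" "u = p @ i # u'" "v = p @ j # v'"
    using parallel_decomp[OF assms(1)] by blast
  have "sim r i x \<noteq> sim r j y" if "x \<in> J r u'" "y \<in> J r v'" for x y
    using uv assms(2,3) by (intro sim_images_disjoint subsetD[OF J_subset that(1)]
      subsetD[OF J_subset that(2)]) auto
  then have "J r (i # u') \<inter> J r (j # v') = {}" by (auto simp: J_def)
  then show ?thesis unfolding uv J_append using word_map_inj by auto
qed

lemma integrable_word_map:
  fixes f :: "real \<Rightarrow> real"
  assumes "integrable P f" "set w \<subseteq> {1, 2}"
  shows "integrable P (\<lambda>x. f (word_map r w x))"
  using assms
proof (induction w arbitrary: f)
  case (Cons i w)
  then show ?case using integrable_sim[of f i] by (auto intro: Cons.IH[of "\<lambda>x. f (sim r i x)"])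
qed simp

text \<open>
  By induction on the word: of the two terms in the self-similarity equation only the one for the
  first letter survives, since the other similarity maps the support away from the cylinder.
\<close>

lemma integral_cylinder:
  fixes f :: "real \<Rightarrow> real"
  assumes "integrable P f" "set w \<subseteq> {1, 2}"
  shows "(LINT x:J r w|P. f x) = (1/2) ^ length w * (LINT x|P. f (word_map r w x))"
  using assms
proof (induction w arbitrary: f)
  case Nil
  have "(LINT x:{0..1}|P. f x) = (LINT x|P. f x)"
    unfolding set_lebesgue_integral_def
    using AE_unit_interval borel_measurable_integrable[OF Nil(1)]
    by (intro integral_cong_AE) auto
  then show ?case by (simp add: J_def)
next
  case (Cons i w)
  define g where "g x = indicator (J r (i # w)) x *\<^sub>R f x" for x
  have i: "i \<in> {1, 2}" and w: "set w \<subseteq> {1, 2}" using Cons.prems by auto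
  have g: "integrable P g"
    unfolding g_def using Cons.prems(1) by (intro integrable_mult_indicator) auto
  have same: "(LINT x|P. g (sim r i x)) = (1/2) ^ length w * (LINT x|P. f (word_map r (i # w) x))"
  proof -
    have "sim r i x \<in> J r (i # w) \<longleftrightarrow> x \<in> J r w" for x
      using word_map_inj[of "[i]" x] by (auto simp: J_def)
    then have "(LINT x|P. g (sim r i x)) = (LINT x:J r w|P. f (sim r i x))"
      by (simp add: g_def set_lebesgue_integral_def indicator_def)
    then show ?thesis using Cons.IH[of "\<lambda>x. f (sim r i x)"] integrable_sim[OF Cons.prems(1) i] w by simp
  qed
  have other: "(LINT x|P. g (sim r j x)) = 0" if "j \<in> {1, 2}" "j \<noteq> i" for j
  proof -
    have "AE x in P. g (sim r j x) = 0"
      using AE_unit_interval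
    proof eventually_elim
      case (elim x)
      have "J r (i # w) = sim r i ` J r w" by (auto simp: J_def)
      then have "sim r j x \<notin> J r (i # w)"
        using sim_images_disjoint[OF \<open>j \<in> {1, 2}\<close> i \<open>j \<noteq> i\<close> elim] J_subset[of w] by blast
      then show ?case by (simp add: g_def)
    qed
    then show ?thesis by (rule integral_eq_zero_AE)
  qed
  have "(LINT x|P. g x) = 1/2 * (LINT x|P. g (sim r i x))"
    using integral_self_similar[OF g] other i by auto
  then show ?case using same by (simp add: g_def set_lebesgue_integral_def)
qed

lemma integral_words:
  fixes f :: "real \<Rightarrow> real"
  assumes "integrable P f"
  shows "(LINT x|P. f x) = (1/2) ^ k * (\<Sum>w\<in>words k. LINT x|P. f (word_map r w x))"
  using assms
proof (induction k arbitrary: f)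
  case 0
  then show ?case by (simp add: words_0)
next
  case (Suc k)
  have "(\<Sum>w\<in>words (Suc k). LINT x|P. f (word_map r w x)) =
      (\<Sum>w\<in>words k. LINT x|P. f (sim r 1 (word_map r w x))) +
      (\<Sum>w\<in>words k. LINT x|P. f (sim r 2 (word_map r w x)))"
    unfolding words_Suc
    by (subst sum.union_disjoint) (auto simp: finite_words sum.reindex)
  then show ?case
    using integral_self_similar[OF Suc.prems] Suc.IH[OF integrable_sim[OF Suc.prems], of 1]
      Suc.IH[OF integrable_sim[OF Suc.prems], of 2]
    by (simp add: algebra_simps)
qed

lemma integral_prefix_code:
  fixes f :: "real \<Rightarrow> real"
  assumes "prefix_code W" "integrable P f"
  shows "(LINT x:(\<Union>w\<in>W. J r w)|P. f x) = (\<Sum>w\<in>W. (1/2) ^ length w * (LINT x|P. f (word_map r w x)))"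
proof -
  have "disjoint_family_on (J r) W"
    using assms(1) J_parallel_disjoint by (auto simp: disjoint_family_on_def prefix_code_def)
  moreover have "set_integrable P (J r w) f" for w
    unfolding set_integrable_def using assms(2) by (intro integrable_mult_indicator) auto
  ultimately have "(LINT x:(\<Union>w\<in>W. J r w)|P. f x) = (\<Sum>w\<in>W. LINT x:J r w|P. f x)"
    using assms(1) by (intro set_integral_finite_Union) (auto simp: prefix_code_def)
  also have "\<dots> = (\<Sum>w\<in>W. (1/2) ^ length w * (LINT x|P. f (word_map r w x)))"
    using assms by (intro sum.cong refl integral_cylinder) (auto simp: prefix_code_def)
  finally show ?thesis .
qed

lemma measure_prefix_code: "prefix_code W \<Longrightarrow> measure P (\<Union>w\<in>W. J r w) = mass W"
  using integral_prefix_code[of W "\<lambda>_. 1"] prob_space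
  by (simp add: set_lebesgue_integral_def prefix_code_def)

text \<open>
  Complete codes refine the self-similarity equation unevenly, so that cells that are unions of
  cylinders of different levels can be handled directly.
\<close>

lemma integral_complete_prefix_code:
  fixes f :: "real \<Rightarrow> real"
  assumes W: "prefix_code W" "mass W = 1" and f: "integrable P f"
  shows "(LINT x|P. f x) = (\<Sum>w\<in>W. (1/2) ^ length w * (LINT x|P. f (word_map r w x)))"
proof -
  have "(\<Union>w\<in>W. J r w) \<in> events"
    using W(1) by (auto simp: prefix_code_def)
  then have "AE x in P. x \<in> (\<Union>w\<in>W. J r w)"
    using measure_prefix_code[OF W(1)] W(2) by (simp add: prob_eq_1)
  then have "(LINT x:(\<Union>w\<in>W. J r w)|P. f x) = (LINT x|P. f x)"
    unfolding set_lebesgue_integral_def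
    using borel_measurable_integrable[OF f] W(1)
    by (intro integral_cong_AE) (auto simp: prefix_code_def)
  then show ?thesis using integral_prefix_code[OF W(1) f] by simp
qed

lemma integrable_id: "integrable P (\<lambda>x. x)"
  by (rule integrable_bounded_on_unit_interval[of _ 1]) auto

lemma integrable_square: "integrable P (\<lambda>x. x\<^sup>2)"
  by (rule integrable_bounded_on_unit_interval[of _ 1]) (auto simp: power_le_one)

lemma mean: "(LINT x|P. x) = 1/2"
proof -
  have "(LINT x|P. x) = 1/2 * (r * (LINT x|P. x)) + 1/2 * (r * (LINT x|P. x) + (1 - r))"
    using integral_self_similar[OF integrable_id] integrable_id prob_space
    by (simp add: sim_def)
  then have "(1 - r) * ((LINT x|P. x) - 1/2) = 0" by (simp add: field_simps)
  then show ?thesis using r_less by simp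
qed

lemma integral_word_map: "(LINT x|P. word_map r w x) = word_map r w (1/2)"
  unfolding word_map_affine[of r w "_ / 2"]
proof -
  have "(LINT x|P. word_map r w x) = (LINT x|P. word_map r w 0 + r ^ length w * x)"
    by (rule Bochner_Integration.integral_cong[OF refl word_map_affine])
  then show "(LINT x|P. word_map r w x) = word_map r w 0 + r ^ length w * (1/2)"
    using integrable_id mean prob_space by simp
qed

lemma a_pt_prefix_code:
  assumes "prefix_code W"
  shows "a_pt r P W = (\<Sum>w\<in>W. (1/2) ^ length w * word_map r w (1/2)) / mass W"
  unfolding a_pt_def centroid_def measure_prefix_code[OF assms]
    integral_prefix_code[OF assms integrable_id] integral_word_map by simp

lemma prefix_code_append:
  assumes "set u \<subseteq> {1, 2}" "prefix_code W"
  shows "prefix_code ((@) u ` W)"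
  using assms by (auto simp: prefix_code_def parallel_def)

text \<open>
  A similarity carries centroids to centroids: all masses shrink by the same factor, and
  \<open>word_map r u\<close> is affine.
\<close>

lemma a_pt_append:
  assumes "set u \<subseteq> {1, 2}" "prefix_code W" "W \<noteq> {}"
  shows "a_pt r P ((@) u ` W) = word_map r u (a_pt r P W)"
proof -
  have inj: "inj_on ((@) u) W" by (simp add: inj_on_def)
  have m: "mass W > 0" using assms by (auto simp: prefix_code_def intro!: sum_pos)
  have s: "mass ((@) u ` W) = (1/2) ^ length u * mass W"
    by (simp add: sum.reindex[OF inj] power_add sum_distrib_left)
  have "(\<Sum>w\<in>(@) u ` W. (1/2) ^ length w * word_map r w (1/2)) =
    (1/2) ^ length u * (\<Sum>w\<in>W. (1/2) ^ length w * word_map r u (word_map r w (1/2)))"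
    by (simp add: sum.reindex[OF inj] power_add sum_distrib_left word_map_append mult.assoc)
  also have "(\<Sum>w\<in>W. (1/2) ^ length w * word_map r u (word_map r w (1/2))) =
    word_map r u 0 * mass W + r ^ length u * (\<Sum>w\<in>W. (1/2) ^ length w * word_map r w (1/2))"
  proof -
    have "word_map r u (word_map r w (1/2)) = word_map r u 0 + r ^ length u * word_map r w (1/2)" for w
      by (rule word_map_affine)
    then show ?thesis by (simp only:) (simp add: sum.distrib sum_distrib_left algebra_simps)
  qed
  finally have t: "(\<Sum>w\<in>(@) u ` W. (1/2) ^ length w * word_map r w (1/2)) =
    (1/2) ^ length u * (word_map r u 0 * mass W + r ^ length u * (\<Sum>w\<in>W. (1/2) ^ length w * word_map r w (1/2)))" .
  have "a_pt r P ((@) u ` W) = word_map r u 0 + r ^ length u * a_pt r P W"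
    using m unfolding a_pt_prefix_code[OF prefix_code_append[OF assms(1,2)]] a_pt_prefix_code[OF assms(2)] s t
    by (simp add: field_simps)
  then show ?thesis using word_map_affine[of r u "a_pt r P W"] by simp
qed

end

section \<open>Squared distance to a finite set and distortion\<close>

definition sqdist :: "real set \<Rightarrow> real \<Rightarrow> real" where
  "sqdist \<alpha> x = Min ((\<lambda>a. (x - a)\<^sup>2) ` \<alpha>)"

lemma sqdist_le: "finite \<alpha> \<Longrightarrow> a \<in> \<alpha> \<Longrightarrow> sqdist \<alpha> x \<le> (x - a)\<^sup>2"
  by (simp add: sqdist_def)

lemma sqdist_nonneg: "finite \<alpha> \<Longrightarrow> \<alpha> \<noteq> {} \<Longrightarrow> 0 \<le> sqdist \<alpha> x"
  by (simp add: sqdist_def)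

lemma sqdist_eq:
  assumes "finite \<alpha>" "a \<in> \<alpha>" "\<And>b. b \<in> \<alpha> \<Longrightarrow> \<bar>x - a\<bar> \<le> \<bar>x - b\<bar>"
  shows "sqdist \<alpha> x = (x - a)\<^sup>2"
  unfolding sqdist_def using assms
  by (intro Min_eqI) (auto simp: abs_le_square_iff)

lemma nearest_exists:
  fixes x :: real
  assumes "finite \<alpha>" "\<alpha> \<noteq> {}"
  obtains a where "a \<in> \<alpha>" "\<And>b. b \<in> \<alpha> \<Longrightarrow> \<bar>x - a\<bar> \<le> \<bar>x - b\<bar>"
  using arg_min_if_finite(1)[OF assms, of "\<lambda>a. \<bar>x - a\<bar>"] arg_min_least[OF assms, of _ "\<lambda>a. \<bar>x - a\<bar>"]
  by blast

lemma sqdist_image_word_map: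
  assumes "finite L" "L \<noteq> {}"
  shows "sqdist (word_map r w ` L) (word_map r w y) = (r ^ length w)\<^sup>2 * sqdist L y"
proof -
  obtain a where a: "a \<in> L" "\<And>b. b \<in> L \<Longrightarrow> \<bar>y - a\<bar> \<le> \<bar>y - b\<bar>"
    using nearest_exists[OF assms] by blast
  have diff: "word_map r w y - word_map r w b = r ^ length w * (y - b)" for b
    unfolding right_diff_distrib
    using word_map_affine[of r w y] word_map_affine[of r w b] by linarith
  have "sqdist (word_map r w ` L) (word_map r w y) = (word_map r w y - word_map r w a)\<^sup>2"
    using a assms by (intro sqdist_eq) (auto simp: diff abs_mult mult_left_mono)
  then show ?thesis
    using sqdist_eq[OF assms(1) a] by (simp add: diff power_mult_distrib)
qed

lemma nearer_left: "p \<le> q \<Longrightarrow> x \<le> (p + q) / 2 \<Longrightarrow> \<bar>x - p\<bar> \<le> \<bar>x - q\<bar>" for x :: real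
  by (simp add: abs_if)

lemma nearer_right: "p \<le> q \<Longrightarrow> (p + q) / 2 \<le> x \<Longrightarrow> \<bar>x - q\<bar> \<le> \<bar>x - p\<bar>" for x :: real
  by (simp add: abs_if)

context cantor
begin

lemma sqdist_measurable [measurable]: "finite \<alpha> \<Longrightarrow> sqdist \<alpha> \<in> borel_measurable borel"
  unfolding sqdist_def[abs_def] by (rule borel_measurable_Min) auto

lemma integrable_sqdist:
  assumes "finite \<alpha>" "\<alpha> \<noteq> {}"
  shows "integrable P (sqdist \<alpha>)"
proof -
  obtain a where "a \<in> \<alpha>" using assms by auto
  show ?thesis
  proof (rule integrable_bounded_on_unit_interval[of _ "(1 + \<bar>a\<bar>)\<^sup>2"])
    fix x :: real assume "x \<in> {0..1}"
    then have "\<bar>x - a\<bar> \<le> \<bar>1 + \<bar>a\<bar>\<bar>" by auto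
    then have "(x - a)\<^sup>2 \<le> (1 + \<bar>a\<bar>)\<^sup>2" by (simp only: abs_le_square_iff)
    then show "\<bar>sqdist \<alpha> x\<bar> \<le> (1 + \<bar>a\<bar>)\<^sup>2"
      using sqdist_nonneg[OF assms, of x] sqdist_le[OF assms(1) \<open>a \<in> \<alpha>\<close>, of x] by linarith
  qed (use assms in measurable)
qed

lemma distortion_eq_integral_sqdist: "distortion P \<alpha> = (LINT x|P. sqdist \<alpha> x)"
  by (simp add: distortion_def sqdist_def)

lemma distortion_nonneg: "finite \<alpha> \<Longrightarrow> \<alpha> \<noteq> {} \<Longrightarrow> 0 \<le> distortion P \<alpha>"
  by (simp add: distortion_eq_integral_sqdist sqdist_nonneg)

lemma AE_word_map_in_J: "AE x in P. word_map r w x \<in> J r w"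
  using AE_unit_interval by eventually_elim (simp add: J_def)

text \<open>
  Subtracting \<open>x\<^sup>2\<close> from the integrand leaves, on each cylinder, an affine function of \<open>x\<close>, whose
  integral only involves the midpoint of the cylinder. The second moment of \<open>P\<close> appears as a common
  summand, which cancels when two finite sets are compared.
\<close>

lemma
  assumes W: "prefix_code W" "mass W = 1" and \<alpha>: "finite \<alpha>" and c: "\<And>w. w \<in> W \<Longrightarrow> c w \<in> \<alpha>"
  shows distortion_le_cells: "distortion P \<alpha> \<le> (LINT x|P. x\<^sup>2) +
      (\<Sum>w\<in>W. (1/2) ^ length w * ((c w)\<^sup>2 - 2 * c w * word_map r w (1/2)))"
    and distortion_eq_cells:
      "(\<And>w x b. \<lbrakk>w \<in> W; x \<in> J r w; b \<in> \<alpha>\<rbrakk> \<Longrightarrow> \<bar>x - c w\<bar> \<le> \<bar>x - b\<bar>) \<Longrightarrow>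
       distortion P \<alpha> = (LINT x|P. x\<^sup>2) +
         (\<Sum>w\<in>W. (1/2) ^ length w * ((c w)\<^sup>2 - 2 * c w * word_map r w (1/2)))"
proof -
  define f where "f x = sqdist \<alpha> x - x\<^sup>2" for x
  have "W \<noteq> {}" using W(2) by auto
  then have \<alpha>': "\<alpha> \<noteq> {}" using c by auto
  have f: "integrable P f"
    unfolding f_def using integrable_sqdist[OF \<alpha> \<alpha>'] integrable_square by simp
  have "distortion P \<alpha> = (LINT x|P. x\<^sup>2) + (LINT x|P. f x)"
    unfolding f_def distortion_eq_integral_sqdist
    using integrable_sqdist[OF \<alpha> \<alpha>'] integrable_square by simp
  also note integral_complete_prefix_code[OF W f]
  finally have D: "distortion P \<alpha> =
    (LINT x|P. x\<^sup>2) + (\<Sum>w\<in>W. (1/2) ^ length w * (LINT x|P. f (word_map r w x)))" .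
  have int: "integrable P (\<lambda>x. f (word_map r w x))" if "w \<in> W" for w
    using W(1) that by (intro integrable_word_map[OF f]) (auto simp: prefix_code_def)
  have wint: "integrable P (word_map r w)" if "w \<in> W" for w
    using W(1) that integrable_word_map[OF integrable_id, of w] by (auto simp: prefix_code_def)
  have lin: "(LINT x|P. (c w)\<^sup>2 - 2 * c w * word_map r w x) = (c w)\<^sup>2 - 2 * c w * word_map r w (1/2)"
    if "w \<in> W" for w
    using wint[OF that] prob_space by (simp add: integral_word_map)
  have "(LINT x|P. f (word_map r w x)) \<le> (c w)\<^sup>2 - 2 * c w * word_map r w (1/2)" if "w \<in> W" for w
    unfolding lin[OF that, symmetric]
  proof (rule integral_mono[OF int[OF that]])
    show "f (word_map r w x) \<le> (c w)\<^sup>2 - 2 * c w * word_map r w x" for x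
      using sqdist_le[OF \<alpha> c[OF that], of "word_map r w x"]
      unfolding f_def by (simp add: power2_diff algebra_simps)
  qed (use wint[OF that] in simp)
  then show "distortion P \<alpha> \<le> (LINT x|P. x\<^sup>2) +
      (\<Sum>w\<in>W. (1/2) ^ length w * ((c w)\<^sup>2 - 2 * c w * word_map r w (1/2)))"
    unfolding D by (intro add_left_mono sum_mono mult_left_mono) auto
  assume near: "\<And>w x b. \<lbrakk>w \<in> W; x \<in> J r w; b \<in> \<alpha>\<rbrakk> \<Longrightarrow> \<bar>x - c w\<bar> \<le> \<bar>x - b\<bar>"
  have "(LINT x|P. f (word_map r w x)) = (c w)\<^sup>2 - 2 * c w * word_map r w (1/2)" if "w \<in> W" for w
    unfolding lin[OF that, symmetric]
  proof (rule integral_cong_AE)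
    show "AE x in P. f (word_map r w x) = (c w)\<^sup>2 - 2 * c w * word_map r w x"
      using AE_word_map_in_J[of w]
    proof eventually_elim
      case (elim x)
      then have "sqdist \<alpha> (word_map r w x) = (word_map r w x - c w)\<^sup>2"
        using near[OF that] by (intro sqdist_eq[OF \<alpha> c[OF that]]) auto
      then show ?case unfolding f_def by (simp add: power2_diff algebra_simps)
    qed
  qed (use int[OF that] wint[OF that] in auto)
  then show "distortion P \<alpha> = (LINT x|P. x\<^sup>2) +
      (\<Sum>w\<in>W. (1/2) ^ length w * ((c w)\<^sup>2 - 2 * c w * word_map r w (1/2)))"
    unfolding D by simp
qed

text \<open>
  Three points with prescribed cells: any assignment of cells bounds the distortion from above, and
  the assignment is exact if the midpoints between neighbours separate the cells.
\<close>

lemma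
  fixes a1 a2 a3 :: real
  assumes W: "prefix_code (W1 \<union> W2 \<union> W3)" "mass (W1 \<union> W2 \<union> W3) = 1"
    and disj: "W1 \<inter> W2 = {}" "W1 \<inter> W3 = {}" "W2 \<inter> W3 = {}"
  defines "cost \<equiv> \<lambda>W a. \<Sum>w\<in>W. (1/2) ^ length w * (a\<^sup>2 - 2 * a * word_map r w (1/2))"
  shows distortion_three_le:
      "distortion P {a1, a2, a3} \<le> (LINT x|P. x\<^sup>2) + (cost W1 a1 + cost W2 a2 + cost W3 a3)"
    and distortion_three_eq:
      "\<lbrakk>a1 \<le> a2; a2 \<le> a3;
        \<And>w. w \<in> W1 \<Longrightarrow> word_map r w 1 \<le> (a1 + a2) / 2;
        \<And>w. w \<in> W2 \<Longrightarrow> (a1 + a2) / 2 \<le> word_map r w 0 \<and> word_map r w 1 \<le> (a2 + a3) / 2;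
        \<And>w. w \<in> W3 \<Longrightarrow> (a2 + a3) / 2 \<le> word_map r w 0\<rbrakk> \<Longrightarrow>
       distortion P {a1, a2, a3} = (LINT x|P. x\<^sup>2) + (cost W1 a1 + cost W2 a2 + cost W3 a3)"
proof -
  define c where "c w = (if w \<in> W1 then a1 else if w \<in> W2 then a2 else a3)" for w
  have c: "c w \<in> {a1, a2, a3}" for w by (simp add: c_def)
  have fin: "finite W1" "finite W2" "finite W3" using W(1) by (auto simp: prefix_code_def)
  have "(\<Sum>w\<in>W1 \<union> W2 \<union> W3. (1/2) ^ length w * ((c w)\<^sup>2 - 2 * c w * word_map r w (1/2))) =
      (\<Sum>w\<in>W1. (1/2) ^ length w * ((c w)\<^sup>2 - 2 * c w * word_map r w (1/2))) +
      (\<Sum>w\<in>W2. (1/2) ^ length w * ((c w)\<^sup>2 - 2 * c w * word_map r w (1/2))) +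
      (\<Sum>w\<in>W3. (1/2) ^ length w * ((c w)\<^sup>2 - 2 * c w * word_map r w (1/2)))"
    using fin disj by (subst sum.union_disjoint, simp, simp, blast)+ simp
  also have "\<dots> = cost W1 a1 + cost W2 a2 + cost W3 a3"
    unfolding cost_def using disj
    by (intro arg_cong2[of _ _ _ _ "(+)"] sum.cong) (auto simp: c_def)
  finally have S: "(\<Sum>w\<in>W1 \<union> W2 \<union> W3. (1/2) ^ length w * ((c w)\<^sup>2 - 2 * c w * word_map r w (1/2))) =
      cost W1 a1 + cost W2 a2 + cost W3 a3" .
  show "distortion P {a1, a2, a3} \<le> (LINT x|P. x\<^sup>2) + (cost W1 a1 + cost W2 a2 + cost W3 a3)"
    unfolding S[symmetric] by (rule distortion_le_cells[OF W]) (use c in auto)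
  assume a: "a1 \<le> a2" "a2 \<le> a3"
    and v: "\<And>w. w \<in> W1 \<Longrightarrow> word_map r w 1 \<le> (a1 + a2) / 2"
        "\<And>w. w \<in> W2 \<Longrightarrow> (a1 + a2) / 2 \<le> word_map r w 0 \<and> word_map r w 1 \<le> (a2 + a3) / 2"
        "\<And>w. w \<in> W3 \<Longrightarrow> (a2 + a3) / 2 \<le> word_map r w 0"
  have near: "\<bar>x - c w\<bar> \<le> \<bar>x - b\<bar>"
    if w: "w \<in> W1 \<union> W2 \<union> W3" and x: "x \<in> J r w" and b: "b \<in> {a1, a2, a3}" for w x b
  proof -
    have x: "word_map r w 0 \<le> x" "x \<le> word_map r w 1" using x mem_J_iff by auto
    have "w \<notin> W1" if "w \<in> W2" using disj that by blast
    moreover have "w \<notin> W1" "w \<notin> W2" if "w \<in> W3" using disj that by blast+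
    ultimately consider "w \<in> W1" "c w = a1" | "w \<in> W2" "c w = a2" | "w \<in> W3" "c w = a3"
      using w unfolding c_def by auto
    then show ?thesis
    proof cases
      case 1
      then have "x \<le> (a1 + a2) / 2" "x \<le> (a1 + a3) / 2" using v(1)[of w] x a by (auto simp: add_divide_distrib)
      then show ?thesis using b 1 a nearer_left[of a1 a2] nearer_left[of a1 a3] by auto
    next
      case 2
      then have "(a1 + a2) / 2 \<le> x" "x \<le> (a2 + a3) / 2" using v(2)[of w] x by linarith+
      then show ?thesis using b 2 a nearer_right[of a1 a2] nearer_left[of a2 a3] by auto
    next
      case 3
      then have "(a1 + a3) / 2 \<le> x" "(a2 + a3) / 2 \<le> x" using v(3)[of w] x a by (auto simp: add_divide_distrib)
      then show ?thesis using b 3 a nearer_right[of a1 a3] nearer_right[of a2 a3] by auto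
    qed
  qed
  show "distortion P {a1, a2, a3} = (LINT x|P. x\<^sup>2) + (cost W1 a1 + cost W2 a2 + cost W3 a3)"
    unfolding S[symmetric] by (rule distortion_eq_cells[OF W]) (use c near in auto)
qed

end

section \<open>Distortion is additive over blocks\<close>

text \<open>
  A local configuration that can compete for every point of its own block with points of the
  neighbouring blocks, which lie at least a quarter of the block length away.
\<close>

definition wide :: "real set \<Rightarrow> bool" where
  "wide L \<longleftrightarrow> finite L \<and> L \<subseteq> {0..1} \<and> (\<exists>p\<in>L. p \<le> 1/4) \<and> (\<exists>p\<in>L. 3/4 \<le> p)"

context cantor
begin

text \<open>
  The gap between the two first-level cylinders is \<open>1 - 2r \<ge> r/4\<close>, and blocks whose words share a
  prefix are scaled copies of blocks of lower level.
\<close>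

lemma blocks_separated:
  assumes "r \<le> 4/9" "\<sigma> \<in> words k" "\<tau> \<in> words k" "\<sigma> \<noteq> \<tau>" "x \<in> J r \<sigma>" "y \<in> J r \<tau>"
  shows "r ^ k / 4 \<le> \<bar>x - y\<bar>"
  using assms(2-)
proof (induction k arbitrary: \<sigma> \<tau> x y)
  case 0
  then show ?case by (simp add: words_0)
next
  case (Suc k)
  obtain i \<sigma>' where \<sigma>: "\<sigma> = i # \<sigma>'" "i \<in> {1, 2}" "\<sigma>' \<in> words k"
    using Suc.prems(1) unfolding words_Suc by auto
  obtain j \<tau>' where \<tau>: "\<tau> = j # \<tau>'" "j \<in> {1, 2}" "\<tau>' \<in> words k"
    using Suc.prems(2) unfolding words_Suc by auto
  obtain x' where x': "x = sim r i x'" "x' \<in> J r \<sigma>'"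
    using Suc.prems(4) \<sigma> by (auto simp: J_def)
  obtain y' where y': "y = sim r j y'" "y' \<in> J r \<tau>'"
    using Suc.prems(5) \<tau> by (auto simp: J_def)
  show ?case
  proof (cases "i = j")
    case True
    then have "r ^ k / 4 \<le> \<bar>x' - y'\<bar>"
      using Suc.IH[OF \<sigma>(3) \<tau>(3) _ x'(2) y'(2)] Suc.prems(3) \<sigma> \<tau> by simp
    then have "r * (r ^ k / 4) \<le> r * \<bar>x' - y'\<bar>" using r_pos by (intro mult_left_mono) auto
    moreover have "x - y = r * (x' - y')"
      using True x' y' by (simp add: sim_def algebra_simps)
    ultimately show ?thesis using r_pos by (simp add: abs_mult)
  next
    case False
    have "x' \<in> {0..1}" "y' \<in> {0..1}" using x' y' J_subset by blast+
    then have b: "0 \<le> r * x'" "r * x' \<le> r" "0 \<le> r * y'" "r * y' \<le> r"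
      using r_pos by (auto simp: mult_left_le)
    have "r * r ^ k \<le> r * 1"
      using r_pos r_less by (intro mult_left_mono power_le_one) auto
    then have "r ^ Suc k / 4 \<le> 1 - 2 * r" using assms(1) by simp
    moreover have "1 - 2 * r \<le> \<bar>x - y\<bar>"
    proof -
      consider "i = 1" "j = 2" | "i = 2" "j = 1" using False \<sigma>(2) \<tau>(2) by blast
      then show ?thesis
      proof cases
        case 1
        then show ?thesis unfolding x' y' sim_def using b r_less by simp
      next
        case 2
        then show ?thesis unfolding x' y' sim_def using b r_less by simp
      qed
    qed
    ultimately show ?thesis by linarith
  qed
qed

text \<open>
  A competitor \<open>q\<close> outside the block lies beyond one of its ends by at least a quarter of the block
  length, and the point of the configuration near that end is at least as close to \<open>x\<close>.
\<close>

lemma own_block_nearest: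
  assumes r: "r \<le> 4/9" and \<sigma>: "\<sigma> \<in> words k" and \<tau>: "\<tau> \<in> words k" and "\<sigma> \<noteq> \<tau>"
    and x: "x \<in> J r \<sigma>" and q: "q \<in> J r \<tau>" and L: "wide L"
  shows "\<exists>p\<in>word_map r \<sigma> ` L. \<bar>x - p\<bar> \<le> \<bar>x - q\<bar>"
proof -
  have len: "length \<sigma> = k" using \<sigma> by (simp add: words_def)
  note sep = blocks_separated[OF r \<sigma> \<tau> \<open>\<sigma> \<noteq> \<tau>\<close> _ q]
  have w1: "word_map r \<sigma> 1 = word_map r \<sigma> 0 + r ^ k" using word_map_affine[of r \<sigma> 1] len by simp
  have xb: "word_map r \<sigma> 0 \<le> x" "x \<le> word_map r \<sigma> 1" using x mem_J_iff by auto
  have rk: "0 < r ^ k" using r_pos by simp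
  have out: "q \<le> word_map r \<sigma> 0 - r ^ k / 4 \<or> word_map r \<sigma> 1 + r ^ k / 4 \<le> q"
  proof -
    have *: "q \<notin> J r \<sigma>" using sep[of q] rk by auto
    have s: "r ^ k / 4 \<le> \<bar>word_map r \<sigma> 0 - q\<bar>" "r ^ k / 4 \<le> \<bar>word_map r \<sigma> 1 - q\<bar>"
      using w1 rk by (intro sep; simp add: mem_J_iff)+
    show ?thesis using * s by (auto simp: mem_J_iff)
  qed
  then show ?thesis
  proof
    assume q: "q \<le> word_map r \<sigma> 0 - r ^ k / 4"
    obtain p where p: "p \<in> L" "0 \<le> p" "p \<le> 1/4" using L by (auto simp: wide_def)
    have e: "word_map r \<sigma> p = word_map r \<sigma> 0 + r ^ k * p" using word_map_affine[of r \<sigma> p] len by simp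
    have "r ^ k * p \<le> r ^ k / 4" "0 \<le> r ^ k * p" using p rk by (simp_all add: field_simps)
    then have "\<bar>x - word_map r \<sigma> p\<bar> \<le> \<bar>x - q\<bar>" using e q xb by (simp add: abs_le_iff) 
    then show ?thesis using p by blast
  next
    assume q: "word_map r \<sigma> 1 + r ^ k / 4 \<le> q"
    obtain p where p: "p \<in> L" "p \<le> 1" "3/4 \<le> p" using L by (auto simp: wide_def)
    have e: "word_map r \<sigma> p = word_map r \<sigma> 0 + r ^ k * p" using word_map_affine[of r \<sigma> p] len by simp
    have "r ^ k * p \<le> r ^ k" "r ^ k * (3/4) \<le> r ^ k * p" using p rk by (auto simp: mult_left_le intro: mult_left_mono)
    then have "\<bar>x - word_map r \<sigma> p\<bar> \<le> \<bar>x - q\<bar>" using e q xb w1 by (simp add: abs_le_iff)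
    then show ?thesis using p by blast
  qed
qed

text \<open>
  The nearest point to \<open>S\<^sub>\<sigma>(y)\<close> lies in its own block, where the squared distance is that of the
  unscaled configuration times \<open>r ^ (2k)\<close>; averaging over the \<open>2 ^ k\<close> blocks gives the other factor.
\<close>

lemma distortion_blocks:
  assumes r: "r \<le> 4/9" and L: "\<And>\<sigma>. \<sigma> \<in> words k \<Longrightarrow> wide (L \<sigma>)"
  shows "distortion P (\<Union>\<sigma>\<in>words k. word_map r \<sigma> ` L \<sigma>) =
    (r\<^sup>2 / 2) ^ k * (\<Sum>\<sigma>\<in>words k. distortion P (L \<sigma>))"
proof -
  define \<alpha> where "\<alpha> = (\<Union>\<sigma>\<in>words k. word_map r \<sigma> ` L \<sigma>)"
  have Lf: "finite (L \<sigma>)" "L \<sigma> \<noteq> {}" "L \<sigma> \<subseteq> {0..1}" if "\<sigma> \<in> words k" for \<sigma>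
    using L[OF that] by (auto simp: wide_def)
  have fin: "finite \<alpha>" unfolding \<alpha>_def using Lf finite_words by auto
  have "words k \<noteq> {}" using card_words[of k] by force
  then have ne: "\<alpha> \<noteq> {}" unfolding \<alpha>_def using Lf by auto
  have local: "sqdist \<alpha> (word_map r \<sigma> y) = (r ^ k)\<^sup>2 * sqdist (L \<sigma>) y"
    if \<sigma>: "\<sigma> \<in> words k" and y: "y \<in> {0..1}" for \<sigma> y
  proof -
    define x where "x = word_map r \<sigma> y"
    have x: "x \<in> J r \<sigma>" unfolding x_def J_def using y by blast
    obtain a where a: "a \<in> word_map r \<sigma> ` L \<sigma>" "\<And>b. b \<in> word_map r \<sigma> ` L \<sigma> \<Longrightarrow> \<bar>x - a\<bar> \<le> \<bar>x - b\<bar>"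
      using nearest_exists[of "word_map r \<sigma> ` L \<sigma>" x] Lf[OF \<sigma>] by auto
    have "\<bar>x - a\<bar> \<le> \<bar>x - q\<bar>" if q: "q \<in> \<alpha>" for q
    proof -
      obtain \<tau> where \<tau>: "\<tau> \<in> words k" "q \<in> word_map r \<tau> ` L \<tau>" using q by (auto simp: \<alpha>_def)
      show ?thesis
      proof (cases "\<tau> = \<sigma>")
        case True
        then show ?thesis using a \<tau> by auto
      next
        case False
        have "q \<in> J r \<tau>" using \<tau> Lf(3)[OF \<tau>(1)] by (auto simp: J_def)
        then show ?thesis
          using own_block_nearest[OF r \<sigma> \<tau>(1) _ x _ L[OF \<sigma>], of q] False a(2) by fastforce
      qed
    qed
    moreover have "a \<in> \<alpha>" using a \<sigma> by (auto simp: \<alpha>_def)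
    ultimately have "sqdist \<alpha> x = (x - a)\<^sup>2" by (intro sqdist_eq fin)
    also have "\<dots> = sqdist (word_map r \<sigma> ` L \<sigma>) x" using a Lf[OF \<sigma>] by (intro sqdist_eq[symmetric]) auto
    also have "\<dots> = (r ^ k)\<^sup>2 * sqdist (L \<sigma>) y"
      unfolding x_def using \<sigma> by (simp add: sqdist_image_word_map Lf words_def)
    finally show ?thesis by (simp add: x_def)
  qed
  have "(LINT y|P. sqdist \<alpha> (word_map r \<sigma> y)) = (r ^ k)\<^sup>2 * distortion P (L \<sigma>)" if \<sigma>: "\<sigma> \<in> words k" for \<sigma>
  proof -
    have "(LINT y|P. sqdist \<alpha> (word_map r \<sigma> y)) = (LINT y|P. (r ^ k)\<^sup>2 * sqdist (L \<sigma>) y)"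
    proof (rule integral_cong_AE)
      show "AE y in P. sqdist \<alpha> (word_map r \<sigma> y) = (r ^ k)\<^sup>2 * sqdist (L \<sigma>) y"
        using AE_unit_interval by eventually_elim (rule local[OF \<sigma>])
    qed (use fin Lf[OF \<sigma>] in measurable)
    then show ?thesis by (simp add: distortion_eq_integral_sqdist)
  qed
  then have "distortion P \<alpha> = (1/2) ^ k * (\<Sum>\<sigma>\<in>words k. (r ^ k)\<^sup>2 * distortion P (L \<sigma>))"
    using integral_words[OF integrable_sqdist[OF fin ne], of k]
    by (simp add: distortion_eq_integral_sqdist)
  moreover have "(r ^ k)\<^sup>2 = (r\<^sup>2) ^ k" by (simp add: mult.commute flip: power_mult)
  ultimately show ?thesis
    by (simp add: \<alpha>_def power_divide flip: sum_distrib_left)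
qed

section \<open>Three-point blocks\<close>

lemma A_left_append: "set \<sigma> \<subseteq> {1, 2} \<Longrightarrow> A_left r P \<sigma> = word_map r \<sigma> ` A_left r P []"
  unfolding A_left_def
  by (simp add: prefix_code_def parallel_def flip: a_pt_append)

lemma A_right_append: "set \<sigma> \<subseteq> {1, 2} \<Longrightarrow> A_right r P \<sigma> = word_map r \<sigma> ` A_right r P []"
  unfolding A_right_def
  by (simp add: prefix_code_def parallel_def flip: a_pt_append)

text \<open>
  The three centroids of \<open>A_left r P []\<close> as polynomials in \<open>r\<close>; reflection in \<open>1/2\<close> gives those of
  \<open>A_right r P []\<close>.
\<close>

definition "c1 = (3 * r + r ^ 4 / 2) / 7"
definition "c2 = (4 - 3 * r + 2 * r\<^sup>2 - r ^ 4 / 2) / 5"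
definition "c3 = 1 - r\<^sup>2 / 2"

lemma a_pt_left:
  "a_pt r P {[1,1], [1,2,1], [1,2,2,1]} = c1"
  "a_pt r P {[1,2,2,2], [2,1]} = c2"
  "a_pt r P {[2,2]} = c3"
  unfolding c1_def c2_def c3_def
  by (subst a_pt_prefix_code;
      simp add: prefix_code_def parallel_def sim_def field_simps power2_eq_square power4_eq_xxxx)+

lemma a_pt_right:
  "a_pt r P {[1,1]} = 1 - c3"
  "a_pt r P {[1,2], [2,1,1,1]} = 1 - c2"
  "a_pt r P {[2,1,1,2], [2,1,2], [2,2]} = 1 - c1"
  unfolding c1_def c2_def c3_def
  by (subst a_pt_prefix_code;
      simp add: prefix_code_def parallel_def sim_def field_simps power2_eq_square power4_eq_xxxx)+

lemma A_left_Nil: "A_left r P [] = {c1, c2, c3}"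
  unfolding A_left_def append_Nil a_pt_left ..

lemma A_right_Nil: "A_right r P [] = {1 - c3, 1 - c2, 1 - c1}"
  unfolding A_right_def append_Nil a_pt_right ..

text \<open>
  The sum is \<open>mass W * a\<^sup>2 - 2 a * (mass W * a)\<close>, as \<open>a\<close> is the weighted mean of the midpoints.
\<close>

lemma cost_centroid:
  assumes "prefix_code W" "W \<noteq> {}" "a_pt r P W = a"
  shows "(\<Sum>w\<in>W. (1/2) ^ length w * (a\<^sup>2 - 2 * a * word_map r w (1/2))) = - mass W * a\<^sup>2"
proof -
  have "mass W > 0" using assms(1,2) by (auto simp: prefix_code_def intro!: sum_pos)
  then have m: "(\<Sum>w\<in>W. (1/2) ^ length w * word_map r w (1/2)) = mass W * a"
    using a_pt_prefix_code[OF assms(1)] assms(3) by simp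
  have "(\<Sum>w\<in>W. (1/2) ^ length w * (a\<^sup>2 - 2 * a * word_map r w (1/2))) =
    mass W * a\<^sup>2 - 2 * a * (\<Sum>w\<in>W. (1/2) ^ length w * word_map r w (1/2))"
    by (simp add: sum_subtractf sum_distrib_left sum_distrib_right algebra_simps)
  then show ?thesis unfolding m by (simp add: power2_eq_square)
qed

end

locale cantor_interval = cantor +
  assumes r_lower: "0.4371985206 < r" and r_upper: "r \<le> 0.4384471872"
begin

text \<open>
  Over the short interval for \<open>r\<close> its powers are replaced by chords from above and by a tangent or
  a constant from below, which turns the later comparisons of polynomials into linear ones. A chord
  bound for \<open>r\<^sup>2\<close> multiplied by \<open>r\<close> yields the chord bounds for the higher powers. The chords are
  those over \<open>[0.4371, 0.4385]\<close>, the tangent is the one at \<open>0.4378\<close>, with rounded coefficients.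
\<close>

lemma power_bounds:
  shows "4371/10000 \<le> r" and "r \<le> 4385/10000"
    and "8756/10000 * r - 19166884/100000000 \<le> r\<^sup>2" and "r\<^sup>2 \<le> 8756/10000 * r - 19166835/100000000"
    and "835/10000 \<le> r ^ 3" and "r ^ 3 \<le> 57500701/100000000 * r - 1678248/10000000"
    and "365/10000 \<le> r ^ 4" and "r ^ 4 \<le> 33565134/100000000 * r - 1102106/10000000"
proof -
  show r: "4371/10000 \<le> r" "r \<le> 4385/10000" using r_lower r_upper by simp_all
  have "0 \<le> (r - 4378/10000)\<^sup>2" by simp
  then show "8756/10000 * r - 19166884/100000000 \<le> r\<^sup>2" by (simp add: power2_eq_square algebra_simps)
  have "0 \<le> (r - 4371/10000) * (4385/10000 - r)" using r by simp
  then show r2: "r\<^sup>2 \<le> 8756/10000 * r - 19166835/100000000" by (simp add: power2_eq_square field_simps)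
  have "r * r\<^sup>2 \<le> r * (8756/10000 * r - 19166835/100000000)" using r2 r by (intro mult_left_mono) auto
  then have r3: "r ^ 3 \<le> 8756/10000 * r\<^sup>2 - 19166835/100000000 * r"
    by (simp add: power2_eq_square power3_eq_cube algebra_simps)
  then show "r ^ 3 \<le> 57500701/100000000 * r - 1678248/10000000" using r2 r by linarith
  have "r * r ^ 3 \<le> r * (8756/10000 * r\<^sup>2 - 19166835/100000000 * r)" using r3 r by (intro mult_left_mono) auto
  then have "r ^ 4 \<le> 8756/10000 * r ^ 3 - 19166835/100000000 * r\<^sup>2"
    by (simp add: power2_eq_square power3_eq_cube power4_eq_xxxx algebra_simps)
  then show "r ^ 4 \<le> 33565134/100000000 * r - 1102106/10000000" using r2 r3 r by linarith
  have "(4371/10000) ^ 3 \<le> r ^ 3" using r by (intro power_mono) auto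
  then show "835/10000 \<le> r ^ 3" by (simp add: power3_eq_cube)
  have "(4371/10000) ^ 4 \<le> r ^ 4" using r by (intro power_mono) auto
  then show "365/10000 \<le> r ^ 4" by (simp add: power4_eq_xxxx)
qed

text \<open>
  The left-hand or right-hand sides without \<open>c1, c2, c3\<close> are end points of the cylinders next to the
  Voronoi boundaries: \<open>J\<^sub>1\<^sub>1, J\<^sub>1\<^sub>2\<^sub>1, J\<^sub>1\<^sub>2\<^sub>2\<^sub>1\<close> end before the first boundary, where \<open>J\<^sub>1\<^sub>2\<^sub>2\<^sub>2\<close> begins at
  \<open>r - r ^ 4\<close>; the second boundary separates \<open>J\<^sub>2\<^sub>1\<close> from \<open>J\<^sub>2\<^sub>2\<close>. The tightest bound,
  \<open>(c1 + c2) / 2 \<le> r - r ^ 4\<close>, has slack of only about \<open>4 / 10 ^ 4\<close> at the lower end of the interval.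
\<close>

lemma voronoi_bounds:
  shows "0 \<le> c1" "c1 \<le> 1/4" "c1 \<le> c2" "c2 \<le> c3" "3/4 \<le> c3" "c3 \<le> 1"
    and "r\<^sup>2 \<le> (c1 + c2) / 2" "r ^ 3 - r\<^sup>2 + r \<le> (c1 + c2) / 2"
    and "r ^ 4 - r ^ 3 + r \<le> (c1 + c2) / 2" and "(c1 + c2) / 2 \<le> r - r ^ 4"
    and "(c1 + c2) / 2 \<le> 1 - r" and "r \<le> (c2 + c3) / 2"
    and "r\<^sup>2 - r + 1 \<le> (c2 + c3) / 2" and "(c2 + c3) / 2 \<le> 1 - r\<^sup>2"
proof -
  note b = power_bounds
  show "0 \<le> c1" "c1 \<le> 1/4" "c1 \<le> c2" "c2 \<le> c3" "3/4 \<le> c3" "c3 \<le> 1"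
    "r\<^sup>2 \<le> (c1 + c2) / 2" "r ^ 3 - r\<^sup>2 + r \<le> (c1 + c2) / 2"
    "r ^ 4 - r ^ 3 + r \<le> (c1 + c2) / 2" "(c1 + c2) / 2 \<le> r - r ^ 4"
    "(c1 + c2) / 2 \<le> 1 - r" "r \<le> (c2 + c3) / 2"
    "r\<^sup>2 - r + 1 \<le> (c2 + c3) / 2" "(c2 + c3) / 2 \<le> 1 - r\<^sup>2"
    unfolding c1_def c2_def c3_def add_divide_distrib diff_divide_distrib using b by - linarith+
qed

lemma distortion_A_left:
  "distortion P (A_left r P []) = (LINT x|P. x\<^sup>2) - (7 * c1\<^sup>2 + 5 * c2\<^sup>2 + 4 * c3\<^sup>2) / 16"
proof -
  have code: "prefix_code {[1,1], [1,2,1], [1,2,2,1]}" "prefix_code {[1,2,2,2], [2,1]}" "prefix_code {[2,2]}"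
    by (simp_all add: prefix_code_def parallel_def)
  have "distortion P (A_left r P []) = (LINT x|P. x\<^sup>2) +
      ((\<Sum>w\<in>{[1,1], [1,2,1], [1,2,2,1]}. (1/2) ^ length w * (c1\<^sup>2 - 2 * c1 * word_map r w (1/2))) +
       (\<Sum>w\<in>{[1,2,2,2], [2,1]}. (1/2) ^ length w * (c2\<^sup>2 - 2 * c2 * word_map r w (1/2))) +
       (\<Sum>w\<in>{[2,2]}. (1/2) ^ length w * (c3\<^sup>2 - 2 * c3 * word_map r w (1/2))))"
    unfolding A_left_Nil
  proof (rule distortion_three_eq)
    show "prefix_code ({[1,1], [1,2,1], [1,2,2,1]} \<union> {[1,2,2,2], [2,1]} \<union> {[2,2]})"
      by (simp add: prefix_code_def parallel_def)
  qed (use voronoi_bounds in \<open>auto simp: sim_def power2_eq_square power3_eq_cube power4_eq_xxxx field_simps\<close>)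
  also have "\<dots> = (LINT x|P. x\<^sup>2) - (7 * c1\<^sup>2 + 5 * c2\<^sup>2 + 4 * c3\<^sup>2) / 16"
    unfolding cost_centroid[OF code(1) insert_not_empty a_pt_left(1)]
      cost_centroid[OF code(2) insert_not_empty a_pt_left(2)]
      cost_centroid[OF code(3) insert_not_empty a_pt_left(3)]
    by (simp add: field_simps)
  finally show ?thesis .
qed

lemma distortion_A_right:
  "distortion P (A_right r P []) = (LINT x|P. x\<^sup>2) - (7 * c1\<^sup>2 + 5 * c2\<^sup>2 + 4 * c3\<^sup>2) / 16"
proof -
  \<comment> \<open>The weighted mean of the three centroids is the mean of \<open>P\<close>, so the reflection costs nothing.\<close>
  have mean: "7 * c1 + 5 * c2 + 4 * c3 = 8"
    by (simp add: c1_def c2_def c3_def field_simps)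
  have code: "prefix_code {[1,1]}" "prefix_code {[1,2], [2,1,1,1]}" "prefix_code {[2,1,1,2], [2,1,2], [2,2]}"
    by (simp_all add: prefix_code_def parallel_def)
  have "distortion P (A_right r P []) = (LINT x|P. x\<^sup>2) +
      ((\<Sum>w\<in>{[1,1]}. (1/2) ^ length w * ((1 - c3)\<^sup>2 - 2 * (1 - c3) * word_map r w (1/2))) +
       (\<Sum>w\<in>{[1,2], [2,1,1,1]}. (1/2) ^ length w * ((1 - c2)\<^sup>2 - 2 * (1 - c2) * word_map r w (1/2))) +
       (\<Sum>w\<in>{[2,1,1,2], [2,1,2], [2,2]}. (1/2) ^ length w * ((1 - c1)\<^sup>2 - 2 * (1 - c1) * word_map r w (1/2))))"
    unfolding A_right_Nil
  proof (rule distortion_three_eq)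
    show "prefix_code ({[1,1]} \<union> {[1,2], [2,1,1,1]} \<union> {[2,1,1,2], [2,1,2], [2,2]})"
      by (simp add: prefix_code_def parallel_def)
  qed (use voronoi_bounds in \<open>auto simp: sim_def power2_eq_square power3_eq_cube power4_eq_xxxx field_simps\<close>)
  also have "\<dots> = (LINT x|P. x\<^sup>2) - (7 * c1\<^sup>2 + 5 * c2\<^sup>2 + 4 * c3\<^sup>2) / 16"
    unfolding cost_centroid[OF code(1) insert_not_empty a_pt_right(1)]
      cost_centroid[OF code(2) insert_not_empty a_pt_right(2)]
      cost_centroid[OF code(3) insert_not_empty a_pt_right(3)]
    using mean by (simp add: power2_diff field_simps)
  finally show ?thesis .
qed

text \<open>
  Rational approximations of the centroids of the symmetric cells with masses
  \<open>6/16, 4/16, 6/16\<close>.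
\<close>

definition "better_triple = {4/25, 1/2, 21/25 :: real}"

lemma distortion_better_triple_le:
  "distortion P better_triple \<le> (LINT x|P. x\<^sup>2) - (66928/10000 - 34/25 * r ^ 3 - 68/25 * r) / 16"
proof -
  have "distortion P better_triple \<le> (LINT x|P. x\<^sup>2) +
   ((\<Sum>w\<in>{[1,1],[1,2,1]}. (1/2) ^ length w * ((4/25)\<^sup>2 - 2 * (4/25) * word_map r w (1/2))) +
    (\<Sum>w\<in>{[1,2,2],[2,1,1]}. (1/2) ^ length w * ((1/2)\<^sup>2 - 2 * (1/2) * word_map r w (1/2))) +
    (\<Sum>w\<in>{[2,1,2],[2,2]}. (1/2) ^ length w * ((21/25)\<^sup>2 - 2 * (21/25) * word_map r w (1/2))))"
    unfolding better_triple_def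
    by (rule distortion_three_le) (simp_all add: prefix_code_def parallel_def)
  then show ?thesis
    by (simp add: sim_def field_simps power2_eq_square power3_eq_cube)
qed

text \<open>
  Each squared centroid is replaced by its tangent at a point \<open>m\<close> near the centre of its range; as
  the centroid stays within \<open>1/2000\<close> of \<open>m\<close>, this costs at most \<open>1/4000000\<close>, far below the gain of
  about \<open>10\<^sup>-\<^sup>4\<close>. The remaining inequality is linear in the powers of \<open>r\<close>.
\<close>

lemma distortion_better_triple_less:
  "distortion P better_triple < (LINT x|P. x\<^sup>2) - (7 * c1\<^sup>2 + 5 * c2\<^sup>2 + 4 * c3\<^sup>2) / 16"
proof -
  note b = power_bounds
  have sq: "c\<^sup>2 \<le> 2 * m * c - m * m + 1/4000000" if "\<bar>c - m\<bar> \<le> 1/2000" for c m :: real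
    using abs_le_square_iff[of "c - m" "1/2000"] that by (simp add: power2_eq_square algebra_simps)
  have "\<bar>c1 - 19026/100000\<bar> \<le> 1/2000" "\<bar>c2 - 61031/100000\<bar> \<le> 1/2000" "\<bar>c3 - 90415/100000\<bar> \<le> 1/2000"
    unfolding c1_def c2_def c3_def add_divide_distrib diff_divide_distrib using b by - linarith+
  from this[THEN sq] have "c1\<^sup>2 \<le> 38052/100000 * c1 - 36198/1000000"
    "c2\<^sup>2 \<le> 122062/100000 * c2 - 372478/1000000" "c3\<^sup>2 \<le> 180830/100000 * c3 - 817486/1000000"
    by (simp_all add: field_simps)
  moreover have "c1 = 3 * r / 7 + r ^ 4 / 14" "c2 = 4/5 - 3 * r / 5 + 2 * r\<^sup>2 / 5 - r ^ 4 / 10" "c3 = 1 - r\<^sup>2 / 2"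
    by (simp_all add: c1_def c2_def c3_def field_simps)
  ultimately have "7 * c1\<^sup>2 + 5 * c2\<^sup>2 + 4 * c3\<^sup>2 \<le>
      672996/100000 - 25203/10000 * r - 117536/100000 * r\<^sup>2 - 42005/100000 * r ^ 4"
    by linarith
  also have "\<dots> < 66928/10000 - 34/25 * r ^ 3 - 68/25 * r"
    using b(1,2,3,6,7) by linarith
  finally have "(7 * c1\<^sup>2 + 5 * c2\<^sup>2 + 4 * c3\<^sup>2) / 16 < (66928/10000 - 34/25 * r ^ 3 - 68/25 * r) / 16"
    by (rule divide_strict_right_mono) simp
  then show ?thesis using distortion_better_triple_le by linarith
qed

section \<open>Exchanging one block\<close>

text \<open>
  The exchange argument. The bounds \<open>N\<close> on the sizes, rather than the sizes themselves, are summed, as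
  this avoids showing that the points of a configuration are distinct.
\<close>

lemma not_optimal_if_three_block:
  assumes L: "\<And>\<sigma>. \<sigma> \<in> words k \<Longrightarrow> wide (L \<sigma>)"
    and \<rho>: "\<rho> \<in> words k" "L \<rho> = A_left r P [] \<or> L \<rho> = A_right r P []"
    and N: "\<And>\<sigma>. \<sigma> \<in> words k \<Longrightarrow> card (L \<sigma>) \<le> N \<sigma>" "N \<rho> = 3" "(\<Sum>\<sigma>\<in>words k. N \<sigma>) \<le> n"
  shows "\<not> optimal_means P n (\<Union>\<sigma>\<in>words k. word_map r \<sigma> ` L \<sigma>)"
proof
  assume opt: "optimal_means P n (\<Union>\<sigma>\<in>words k. word_map r \<sigma> ` L \<sigma>)"
  have r: "r \<le> 4/9" using r_upper by simp
  define L' where "L' = L(\<rho> := better_triple)"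
  define \<beta> where "\<beta> = (\<Union>\<sigma>\<in>words k. word_map r \<sigma> ` L' \<sigma>)"
  have "4/25 \<in> better_triple" "21/25 \<in> better_triple" "better_triple \<subseteq> {0..1}" "finite better_triple"
    by (auto simp: better_triple_def)
  then have wide_better_triple: "wide better_triple"
    unfolding wide_def by (intro conjI bexI[of _ "4/25"] bexI[of _ "21/25"]; simp)
  have L': "wide (L' \<sigma>)" if "\<sigma> \<in> words k" for \<sigma>
    using L[OF that] wide_better_triple by (simp add: L'_def)
  have less: "distortion P (L' \<rho>) < distortion P (L \<rho>)"
    using \<rho>(2) distortion_better_triple_less distortion_A_left distortion_A_right by (auto simp: L'_def)
  have "(\<Sum>\<sigma>\<in>words k. distortion P (L' \<sigma>)) < (\<Sum>\<sigma>\<in>words k. distortion P (L \<sigma>))"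
    using \<rho>(1) less by (intro sum_strict_mono_ex1 finite_words) (auto simp: L'_def)
  then have D: "distortion P \<beta> < distortion P (\<Union>\<sigma>\<in>words k. word_map r \<sigma> ` L \<sigma>)"
    using distortion_blocks[of k L, OF r L] distortion_blocks[of k L', OF r L'] r_pos
    by (simp add: \<beta>_def)
  have \<beta>: "finite \<beta>" "\<beta> \<noteq> {}"
    using \<rho>(1) L' finite_words wide_better_triple by (auto simp: \<beta>_def wide_def L'_def)
  have "card \<beta> \<le> (\<Sum>\<sigma>\<in>words k. card (word_map r \<sigma> ` L' \<sigma>))"
    unfolding \<beta>_def by (rule card_UN_le[OF finite_words])
  also have "\<dots> \<le> (\<Sum>\<sigma>\<in>words k. N \<sigma>)"
  proof (rule sum_mono)
    fix \<sigma> assume \<sigma>: "\<sigma> \<in> words k"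
    have "card (L' \<sigma>) \<le> N \<sigma>" using N(1)[OF \<sigma>] N(2) by (simp add: L'_def better_triple_def)
    then show "card (word_map r \<sigma> ` L' \<sigma>) \<le> N \<sigma>"
      using card_image_le[of "L' \<sigma>" "word_map r \<sigma>"] L'[OF \<sigma>] by (auto simp: wide_def)
  qed
  finally have "card \<beta> \<le> n" using N(3) by simp
  then have "(INF \<beta>\<in>{\<beta>. finite \<beta> \<and> \<beta> \<noteq> {} \<and> card \<beta> \<le> n}. distortion P \<beta>) \<le> distortion P \<beta>"
    using \<beta> distortion_nonneg by (intro cINF_lower bdd_belowI2[where m = 0]) auto
  then show False using opt D unfolding optimal_means_def by linarith
qed

lemma wide_A_left: "wide (A_left r P [])" and wide_A_right: "wide (A_right r P [])"
  unfolding A_left_Nil A_right_Nil wide_def using voronoi_bounds by auto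

lemma wide_pairs: "wide {word_map r [1] (1/2), word_map r [2] (1/2)}"
  using r_lower r_upper by (auto simp: wide_def sim_def)

lemma wide_quadruples: "wide ((\<lambda>\<tau>. word_map r \<tau> (1/2)) ` words 2)"
proof -
  have "[1,1] \<in> words 2" "[2,2] \<in> words 2" by (simp_all add: words_def)
  moreover have "word_map r [1,1] (1/2) \<le> 1/4" "3/4 \<le> word_map r [2,2] (1/2)"
    using power_bounds r_lower r_upper by (simp_all add: sim_def power2_eq_square algebra_simps)
  ultimately show ?thesis
    using finite_words word_map_in_unit_interval[of "1/2"] unfolding wide_def by fastforce
qed

end

lemma UN_image_if:
  assumes "I \<subseteq> W"
  shows "(\<Union>w\<in>W. f w ` (if w \<in> I then X w else Y w)) = (\<Union>w\<in>I. f w ` X w) \<union> (\<Union>w\<in>W - I. f w ` Y w)"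
proof -
  have "W = I \<union> (W - I)" using assms by auto
  then have "(\<Union>w\<in>W. f w ` (if w \<in> I then X w else Y w)) =
      (\<Union>w\<in>I. f w ` (if w \<in> I then X w else Y w)) \<union> (\<Union>w\<in>W - I. f w ` (if w \<in> I then X w else Y w))"
    by (metis UN_Un)
  then show ?thesis by simp
qed

lemma level_eq: "2 ^ l < n \<Longrightarrow> n < 2 ^ (l + 1) \<Longrightarrow> level n = l" for n :: nat
  unfolding level_def
proof (rule the_equality)
  fix l' assume n: "2 ^ l < n" "n < 2 ^ (l + 1)" and n': "2 ^ l' < n \<and> n < 2 ^ (l' + 1)"
  have "2 ^ l < (2::nat) ^ (l' + 1)" "2 ^ l' < (2::nat) ^ (l + 1)" using n n' by linarith+
  then have "l < l' + 1" "l' < l + 1" by (simp_all only: power_strict_increasing_iff)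
  then show "l' = l" by simp
qed simp

lemma level_exists:
  fixes n :: nat
  assumes "n \<ge> 2" "\<nexists>l. n = 2 ^ l"
  obtains l where "1 \<le> l" "2 ^ l < n" "n < 2 ^ (l + 1)"
proof -
  obtain l where l: "2 ^ l \<le> n" "n < 2 ^ (l + 1)"
    using ex_power_ivl1[of 2 n] assms(1) by auto
  moreover have "2 ^ l \<noteq> n" using assms(2) by blast
  moreover have "1 \<le> l" using l assms(1) calculation(3) by (cases l) auto
  ultimately show ?thesis using that by auto
qed

theorem theorem5p2:
  fixes r :: real and P :: "real measure" and n :: nat
    and A :: "nat list \<Rightarrow> real set" and I :: "nat list set"
  assumes "0.4371985206 < r" and "r \<le> 0.4384471872"
    and "cantor_distribution r P"
    and "n \<ge> 2" and "\<nexists>l. n = 2 ^ l"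
    and "\<And>k \<sigma>. \<sigma> \<in> words k \<Longrightarrow> A \<sigma> = A_left r P \<sigma> \<or> A \<sigma> = A_right r P \<sigma>"
    and "admissible n I"
  shows "\<not> optimal_CVT P n (alpha r A n I) \<and> \<not> optimal_means P n (alpha r A n I)"
proof -
  interpret cantor_interval r P
    using assms(1-3) by unfold_locales auto
  obtain l where l: "1 \<le> l" "2 ^ l < n" "n < 2 ^ (l + 1)"
    using level_exists[OF assms(4,5)] by blast
  define k where "k = l - 1"
  have lk: "level n = Suc k" "level n - 1 = k" using l level_eq[of l n] by (auto simp: k_def)
  have n: "2 * 2 ^ k < n" "n < 4 * 2 ^ k" using l by (auto simp: k_def power_eq_if)
  have I: "I \<subseteq> words k" and card_I: "card I = (if n \<le> 3 * 2 ^ k then n - 2 * 2 ^ k else n - 3 * 2 ^ k)"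
    using assms(7) by (auto simp: admissible_def lk)
  have fin: "finite I" using I finite_words finite_subset by blast
  have card_compl: "card (words k - I) = 2 ^ k - card I"
    using card_Diff_subset[OF fin I] card_words by simp
  define G where "G \<sigma> = (if A \<sigma> = A_left r P \<sigma> then A_left r P [] else A_right r P [])" for \<sigma>
  have A: "A \<sigma> = word_map r \<sigma> ` G \<sigma>" if "\<sigma> \<in> words k" for \<sigma>
    using assms(6)[OF that] that A_left_append[of \<sigma>] A_right_append[of \<sigma>] by (auto simp: G_def words_def)
  have G: "wide (G \<sigma>)" "card (G \<sigma>) \<le> 3" for \<sigma>
    using wide_A_left wide_A_right by (auto simp: G_def A_left_Nil A_right_Nil card_insert_if)
  define Q where "Q = (\<lambda>\<tau>. word_map r \<tau> (1/2)) ` words 2"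
  define S where "S = {word_map r [1] (1/2), word_map r [2] (1/2)}"
  have card_Q: "card Q \<le> 4"
    using card_image_le[OF finite_words[of 2], of "\<lambda>\<tau>. word_map r \<tau> (1/2)"] by (simp add: card_words Q_def)
  have card_S: "card S \<le> 2" by (simp add: S_def card_insert_if)
  have wide: "wide Q" "wide S" using wide_quadruples wide_pairs by (simp_all add: Q_def S_def)
  have "\<not> optimal_means P n (alpha r A n I)"
  proof (cases "n \<le> 3 * 2 ^ k")
    case True
    define L where "L \<sigma> = (if \<sigma> \<in> I then G \<sigma> else S)" for \<sigma>
    have "alpha r A n I = (\<Union>\<sigma>\<in>I. word_map r \<sigma> ` G \<sigma>) \<union> (\<Union>\<sigma>\<in>words k - I. word_map r \<sigma> ` S)"
    proof -
      have "(\<Union>\<sigma>\<in>I. A \<sigma>) = (\<Union>\<sigma>\<in>I. word_map r \<sigma> ` G \<sigma>)"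
        using I A by (intro SUP_cong) auto
      then show ?thesis using True by (simp add: alpha_def lk S_def word_map_append)
    qed
    also have "\<dots> = (\<Union>\<sigma>\<in>words k. word_map r \<sigma> ` L \<sigma>)"
      unfolding L_def by (rule UN_image_if[OF I, symmetric])
    finally have \<alpha>: "alpha r A n I = (\<Union>\<sigma>\<in>words k. word_map r \<sigma> ` L \<sigma>)" .
    \<comment> \<open>A three-point block exists because \<open>n\<close> exceeds \<open>2 ^ l = 2 * 2 ^ k\<close>.\<close>
    have "card I > 0" using card_I True n by simp
    then obtain \<rho> where \<rho>: "\<rho> \<in> I" by (auto simp: card_gt_0_iff)
    have "(\<Sum>\<sigma>\<in>words k. if \<sigma> \<in> I then 3 else 2 :: nat) = 3 * card I + 2 * card (words k - I)"
      using I finite_words fin by (subst sum.subset_diff[OF I]) auto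
    also have "\<dots> \<le> n" using card_compl card_I True n by simp
    finally show ?thesis
      unfolding \<alpha> using \<rho> I G wide card_S
      by (intro not_optimal_if_three_block[where N = "\<lambda>\<sigma>. if \<sigma> \<in> I then 3 else 2" and \<rho> = \<rho>])
        (auto simp: L_def G_def)
  next
    case False
    define L where "L \<sigma> = (if \<sigma> \<in> I then Q else G \<sigma>)" for \<sigma>
    have "alpha r A n I = (\<Union>\<sigma>\<in>words k - I. word_map r \<sigma> ` G \<sigma>) \<union> (\<Union>\<sigma>\<in>I. word_map r \<sigma> ` Q)"
    proof -
      have "(\<Union>\<sigma>\<in>words k - I. A \<sigma>) = (\<Union>\<sigma>\<in>words k - I. word_map r \<sigma> ` G \<sigma>)"
        using A by (intro SUP_cong) auto
      moreover have "{word_map r (\<sigma> @ \<tau>) (1/2) |\<sigma> \<tau>. \<sigma> \<in> I \<and> \<tau> \<in> words 2} = (\<Union>\<sigma>\<in>I. word_map r \<sigma> ` Q)"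
        by (auto simp: Q_def word_map_append)
      ultimately show ?thesis using False by (simp add: alpha_def lk)
    qed
    also have "\<dots> = (\<Union>\<sigma>\<in>words k. word_map r \<sigma> ` L \<sigma>)"
      unfolding L_def by (subst UN_image_if[OF I]) (rule Un_commute)
    finally have \<alpha>: "alpha r A n I = (\<Union>\<sigma>\<in>words k. word_map r \<sigma> ` L \<sigma>)" .
    \<comment> \<open>A three-point block exists because \<open>n\<close> is below \<open>2 ^ (l + 1) = 4 * 2 ^ k\<close>.\<close>
    have "card (words k - I) > 0" using card_I card_compl False n by simp
    then obtain \<rho> where \<rho>: "\<rho> \<in> words k" "\<rho> \<notin> I" by (auto simp: card_gt_0_iff)
    have "(\<Sum>\<sigma>\<in>words k. if \<sigma> \<in> I then 4 else 3 :: nat) = 4 * card I + 3 * card (words k - I)"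
      using I finite_words fin by (subst sum.subset_diff[OF I]) auto
    also have "\<dots> \<le> n" using card_compl card_I False n by simp
    finally show ?thesis
      unfolding \<alpha> using \<rho> G wide card_Q
      by (intro not_optimal_if_three_block[where N = "\<lambda>\<sigma>. if \<sigma> \<in> I then 4 else 3" and \<rho> = \<rho>])
        (auto simp: L_def G_def)
  qed
  then show ?thesis by (simp add: optimal_CVT_def)
qed

end
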